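(* Let $l$ be a positive integer, $n=4l$, and $G=\mathbb{Z}_{2}\times\mathbb{Z}_{n}$. Let $H=\langle 4\rangle$ be the unique subgroup of $\mathbb{Z}_{n}$ of order $l$, and for $i=0,1,2,3$ let $H+i=\{x\in\mathbb{Z}_{n}: x\equiv i \pmod 4\}$. Then both \[(\{0\}\times(H\cup(H+1)))\cup(\{1\}\times(H\cup(H+3)))\quad\text{and}\quad(\{1\}\times(H\cup(H+1)))\cup(\{0\}\times(H\cup(H+3)))\] are partial geometric difference sets in $G$ with parameters $(8l,4l;6l^{2},10l^{2})$.
   Context: Let $G$ be a finite additive Abelian group of order $v$. For $S\subseteq G$ and $z\in G$, let $\delta_{S}(z)=|\{(x,y)\in S\times S: z=x-y\}|$. Let $v>k>2$ be integers. A $k$-subset $S\subseteq G$ is a partial geometric difference set with parameters $(v,k;\alpha,\beta)$ if there are constants $\alpha,\beta$ such that for every $x\in G$, $\sum_{y\in S}\delta_{S}(x-y)=\alpha$ if $x\in S$ and $=\beta$ if $x\notin S$.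
   Formalization: The roles of α and β in the definition are exchanged: the sum is shown to equal 10l² for x in S and 6l² for x not in S, since with α as the value on S the stated parameters fail (for l=1 the sum at (0,0) in S is 10, not 6). *)

theory Defs
  imports "HOL-Algebra.Elementary_Groups" "HOL-Algebra.Generated_Groups" "HOL-Number_Theory.Cong"
begin

text \<open>The additive group of the mathematics is a commutative group in the multiplicative notation
  of the library, so \<open>x \<otimes>\<^bsub>G\<^esub> inv\<^bsub>G\<^esub> y\<close> is the difference \<open>x - y\<close>.\<close>

definition diff_count :: "('a, 'b) monoid_scheme \<Rightarrow> 'a set \<Rightarrow> 'a \<Rightarrow> nat" where
  "diff_count G S z = card {(x, y) \<in> S \<times> S. z = x \<otimes>\<^bsub>G\<^esub> inv\<^bsub>G\<^esub> y}"

text \<open>Convention: \<open>\<beta>\<close> is the value on \<open>S\<close> and \<open>\<alpha>\<close> the value off \<open>S\<close>, as for the parameters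
  \<open>(v, k, r; \<alpha>, \<beta>)\<close> of partial geometric designs. The two roles are sometimes printed the other way
  round. They are not interchangeable: summing over \<open>x \<in> S\<close> gives \<open>k * \<beta> = (\<Sum>z. \<delta>(z)\<^sup>2) \<ge> k^4 / v\<close>,
  whereas \<open>k * \<beta> + (v - k) * \<alpha> = k^3\<close>, so the value on \<open>S\<close> is always at least the value off \<open>S\<close>.\<close>

definition partial_geometric_difference_set ::
    "('a, 'b) monoid_scheme \<Rightarrow> nat \<Rightarrow> nat \<Rightarrow> nat \<Rightarrow> nat \<Rightarrow> 'a set \<Rightarrow> bool" where
  "partial_geometric_difference_set G v k \<alpha> \<beta> S \<longleftrightarrow>
     comm_group G \<and> finite (carrier G) \<and> order G = v \<and> v > k \<and> k > 2 \<and>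
     S \<subseteq> carrier G \<and> card S = k \<and>
     (\<forall>x\<in>carrier G.
        (\<Sum>y\<in>S. diff_count G S (x \<otimes>\<^bsub>G\<^esub> inv\<^bsub>G\<^esub> y)) = (if x \<in> S then \<beta> else \<alpha>))"

end

theory Submission
  imports Defs
begin

text \<open>Reduction modulo 4 is a homomorphism from \<open>\<int>\<^sub>2 \<times> \<int>\<^sub>4\<^sub>l\<close> onto \<open>\<int>\<^sub>2 \<times> \<int>\<^sub>4\<close> with kernel of order \<open>l\<close>,
  and the two sets are preimages of 4-subsets of a group of order 8. Pulling back along a surjective
  homomorphism with kernel of order \<open>l\<close> multiplies \<open>v\<close> and \<open>k\<close> by \<open>l\<close> and \<open>\<alpha>\<close> and \<open>\<beta>\<close> by
  \<open>l\<^sup>2\<close>, so it suffices to check the parameters \<open>(8, 4; 6, 10)\<close> in \<open>\<int>\<^sub>2 \<times> \<int>\<^sub>4\<close> by hand.\<close>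

text \<open>In a representation z = x - y the element y determines x = z + y, so pairs can be
  replaced by single elements. The resulting set pulls back along homomorphisms and can be evaluated
  by enumeration.\<close>

lemma (in group) diff_count_eq_card_translate:
  assumes S: "S \<subseteq> carrier G" and z: "z \<in> carrier G"
  shows "diff_count G S z = card {y \<in> S. z \<otimes> y \<in> S}"
proof -
  have "bij_betw (\<lambda>y. (z \<otimes> y, y)) {y \<in> S. z \<otimes> y \<in> S} {(x, y) \<in> S \<times> S. z = x \<otimes> inv y}"
    using S z
    by (intro bij_betw_byWitness[where f' = snd])
       (auto simp: subset_iff m_assoc)
  then show ?thesis
    unfolding diff_count_def by (simp add: bij_betw_same_card)
qed

text \<open>The fibre through g is the coset of the kernel by g, so translation by g is the
  bijection.\<close>

lemma (in group_hom) card_fibre_eq_card_kernel: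
  assumes g: "g \<in> carrier G"
  shows "card {x \<in> carrier G. h x = h g} = card (kernel G H h)"
proof -
  have "bij_betw (\<lambda>k. k \<otimes> g) (kernel G H h) {x \<in> carrier G. h x = h g}"
    using g
    by (intro bij_betw_byWitness[where f' = "\<lambda>x. x \<otimes> inv g"])
       (auto simp: kernel_def G.m_assoc)
  then show ?thesis
    by (simp add: bij_betw_same_card)
qed

text \<open>Group the sum by the value of \<open>h\<close>: on each fibre the summand is constant,
  and by surjectivity every fibre over \<open>A\<close> is nonempty, hence a coset of the
  kernel.\<close>

lemma (in group_hom) sum_preimage:
  fixes f :: "'c \<Rightarrow> nat"
  assumes surj: "h ` carrier G = carrier H" and fin: "finite (carrier G)"
    and A: "A \<subseteq> carrier H"
  shows "(\<Sum>x | x \<in> carrier G \<and> h x \<in> A. f (h x)) = card (kernel G H h) * (\<Sum>a\<in>A. f a)"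
proof -
  have finA: "finite A"
    using A surj fin by (metis finite_imageI finite_subset)
  have "(\<Sum>x | x \<in> carrier G \<and> h x \<in> A. f (h x))
      = (\<Sum>a\<in>A. \<Sum>x | x \<in> {x. x \<in> carrier G \<and> h x \<in> A} \<and> h x = a. f (h x))"
    using fin finA by (intro sum.group[symmetric]) auto
  also have "\<dots> = (\<Sum>a\<in>A. card (kernel G H h) * f a)"
  proof (rule sum.cong[OF refl])
    fix a assume a: "a \<in> A"
    then obtain g where g: "g \<in> carrier G" "a = h g"
      using A surj by blast
    have "{x. x \<in> {x. x \<in> carrier G \<and> h x \<in> A} \<and> h x = a} = {x \<in> carrier G. h x = h g}"
      using a g by auto
    then show "(\<Sum>x | x \<in> {x. x \<in> carrier G \<and> h x \<in> A} \<and> h x = a. f (h x))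
        = card (kernel G H h) * f a"
      using g by (simp add: card_fibre_eq_card_kernel)
  qed
  finally show ?thesis
    by (simp add: sum_distrib_left)
qed

lemma (in group_hom) card_preimage:
  assumes "h ` carrier G = carrier H" "finite (carrier G)" "A \<subseteq> carrier H"
  shows "card {x \<in> carrier G. h x \<in> A} = card (kernel G H h) * card A"
  using sum_preimage[OF assms, of "\<lambda>_. 1"] by simp

text \<open>The factor \<open>l\<^sup>2\<close> arises in two steps: each difference count gains one
  factor \<open>l\<close>, and the outer sum over the preimage gains another.\<close>

lemma (in group_hom) partial_geometric_difference_set_preimage:
  assumes comm: "comm_group G" and surj: "h ` carrier G = carrier H" and fin: "finite (carrier G)"
    and T: "partial_geometric_difference_set H v k \<alpha> \<beta> T"
    and l: "l = card (kernel G H h)"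
  shows "partial_geometric_difference_set G (v * l) (k * l) (\<alpha> * l\<^sup>2) (\<beta> * l\<^sup>2)
           {x \<in> carrier G. h x \<in> T}"
proof -
  let ?S = "{x \<in> carrier G. h x \<in> T}"
  have TH: "T \<subseteq> carrier H" and vk: "k < v" "2 < k" and cards: "order H = v" "card T = k"
    and sumT: "\<And>x. x \<in> carrier H \<Longrightarrow>
      (\<Sum>y\<in>T. diff_count H T (x \<otimes>\<^bsub>H\<^esub> inv\<^bsub>H\<^esub> y)) = (if x \<in> T then \<beta> else \<alpha>)"
    using T by (auto simp: partial_geometric_difference_set_def)
  \<comment> \<open>The kernel contains the identity. Positivity of \<open>l\<close> keeps
    \<open>k * l < v * l\<close> strict and gives \<open>2 < k * l\<close>.\<close>
  have l0: "l > 0"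
    unfolding l using fin by (auto simp: kernel_def card_gt_0_iff intro!: exI[of _ \<one>])
  have "{x \<in> carrier G. h x \<in> carrier H} = carrier G"
    by auto
  then have ord: "order G = v * l"
    using card_preimage[OF surj fin order_refl] cards by (simp add: order_def l)
  have card_S: "card ?S = k * l"
    using card_preimage[OF surj fin TH] cards by (simp add: l)
  have diff: "diff_count G ?S z = l * diff_count H T (h z)" if z: "z \<in> carrier G" for z
  proof -
    \<comment> \<open>Since \<open>h\<close> is multiplicative, the set counted in \<open>G\<close>
      is itself the preimage of the set counted in \<open>H\<close>.\<close>
    have "{y \<in> ?S. z \<otimes> y \<in> ?S} = {y \<in> carrier G. h y \<in> {t \<in> T. h z \<otimes>\<^bsub>H\<^esub> t \<in> T}}"
      using z by auto
    moreover have "{t \<in> T. h z \<otimes>\<^bsub>H\<^esub> t \<in> T} \<subseteq> carrier H"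
      using TH by auto
    ultimately have "card {y \<in> ?S. z \<otimes> y \<in> ?S} = l * card {t \<in> T. h z \<otimes>\<^bsub>H\<^esub> t \<in> T}"
      by (simp only: card_preimage[OF surj fin] l)
    then show ?thesis
      using z TH G.diff_count_eq_card_translate[of ?S z] H.diff_count_eq_card_translate[of T "h z"]
      by auto
  qed
  have "(\<Sum>y\<in>?S. diff_count G ?S (x \<otimes> inv y)) = (if x \<in> ?S then \<beta> * l\<^sup>2 else \<alpha> * l\<^sup>2)"
    if x: "x \<in> carrier G" for x
  proof -
    have "(\<Sum>y\<in>?S. diff_count G ?S (x \<otimes> inv y))
        = (\<Sum>y\<in>?S. l * diff_count H T (h x \<otimes>\<^bsub>H\<^esub> inv\<^bsub>H\<^esub> h y))"
      using x by (intro sum.cong) (auto simp: diff)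
    also have "\<dots> = l * (l * (\<Sum>t\<in>T. diff_count H T (h x \<otimes>\<^bsub>H\<^esub> inv\<^bsub>H\<^esub> t)))"
      using sum_preimage[OF surj fin TH, of "\<lambda>t. l * diff_count H T (h x \<otimes>\<^bsub>H\<^esub> inv\<^bsub>H\<^esub> t)"]
      by (simp add: l sum_distrib_left)
    finally show ?thesis
      using x by (simp add: sumT power2_eq_square)
  qed
  moreover have "2 < k * l"
    using vk l0 by (metis less_le_trans mult.right_neutral mult_le_mono2 Suc_leI One_nat_def)
  ultimately show ?thesis
    using comm fin ord card_S vk l0 by (auto simp: partial_geometric_difference_set_def)
qed

lemma carrier_Z2_Z4: "carrier (integer_mod_group 2 \<times>\<times> integer_mod_group 4) = {0, 1} \<times> {0, 1, 2, 3}"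
proof -
  have "{0..<2} = {0, 1 :: int}" "{0..<4} = {0, 1, 2, 3 :: int}"
    by auto
  then show ?thesis
    by (simp add: carrier_integer_mod_group)
qed

lemma comm_group_integer_mod_group_DirProd:
  "comm_group (integer_mod_group m \<times>\<times> integer_mod_group n)"
  by (intro group.group_comm_groupI DirProd_group) (auto simp: add.commute)

text \<open>Rewrites the group operations as integer arithmetic modulo 2 and 4, so that the
  simplifier can compute the sum once \<open>T\<close> and \<open>x\<close> are explicit.\<close>

lemma sum_diff_count_Z2_Z4:
  assumes "T \<subseteq> carrier (integer_mod_group 2 \<times>\<times> integer_mod_group 4)"
    and "x \<in> carrier (integer_mod_group 2 \<times>\<times> integer_mod_group 4)"
  shows "(\<Sum>y\<in>T. diff_count (integer_mod_group 2 \<times>\<times> integer_mod_group 4) T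
           (x \<otimes>\<^bsub>integer_mod_group 2 \<times>\<times> integer_mod_group 4\<^esub>
              inv\<^bsub>integer_mod_group 2 \<times>\<times> integer_mod_group 4\<^esub> y))
       = (\<Sum>(c, d)\<in>T. \<Sum>(a, b)\<in>T.
            if ((fst x - c + a) mod 2, (snd x - d + b) mod 4) \<in> T then 1 else 0)"
proof -
  let ?Q = "integer_mod_group 2 \<times>\<times> integer_mod_group 4"
  interpret Q: comm_group ?Q
    by (rule comm_group_integer_mod_group_DirProd)
  have finT: "finite T"
    using assms(1) by (rule finite_subset) (simp only: carrier_Z2_Z4, simp)
  have "diff_count ?Q T (x \<otimes>\<^bsub>?Q\<^esub> inv\<^bsub>?Q\<^esub> y)
      = (\<Sum>(a, b)\<in>T. if ((fst x - fst y + a) mod 2, (snd x - snd y + b) mod 4) \<in> T then 1 else 0)"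
    if y: "y \<in> T" for y
  proof -
    have yQ: "y \<in> carrier ?Q"
      using y assms by blast
    then have *: "x \<otimes>\<^bsub>?Q\<^esub> inv\<^bsub>?Q\<^esub> y = ((fst x - fst y) mod 2, (snd x - snd y) mod 4)"
      using assms(2)
      by (cases x; cases y) (auto simp: mod_simps)
    have "diff_count ?Q T (x \<otimes>\<^bsub>?Q\<^esub> inv\<^bsub>?Q\<^esub> y) = card {t \<in> T. x \<otimes>\<^bsub>?Q\<^esub> inv\<^bsub>?Q\<^esub> y \<otimes>\<^bsub>?Q\<^esub> t \<in> T}"
      using yQ assms by (intro Q.diff_count_eq_card_translate Q.m_closed Q.inv_closed)
    also have "\<dots> = (\<Sum>t\<in>T. if x \<otimes>\<^bsub>?Q\<^esub> inv\<^bsub>?Q\<^esub> y \<otimes>\<^bsub>?Q\<^esub> t \<in> T then 1 else 0)"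
      using finT by (simp add: sum.inter_filter[symmetric])
    finally show ?thesis
      unfolding * by (simp add: mult_DirProd' mod_simps split_def)
  qed
  then show ?thesis
    by (simp add: split_def)
qed

lemma partial_geometric_difference_set_Z2_Z4:
  assumes T: "T = {(0, 0), (0, 1), (1, 0), (1, 3)} \<or> T = {(1, 0), (1, 1), (0, 0), (0, 3)}"
  shows "partial_geometric_difference_set (integer_mod_group 2 \<times>\<times> integer_mod_group 4) 8 4 6 10 T"
proof -
  let ?Q = "integer_mod_group 2 \<times>\<times> integer_mod_group 4"
  have TQ: "T \<subseteq> carrier ?Q" and "card T = 4"
    using T unfolding carrier_Z2_Z4 by auto
  moreover have "finite (carrier ?Q)" "order ?Q = 8"
    unfolding order_def carrier_Z2_Z4 by (auto simp: card_cartesian_product)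
  moreover have "(\<Sum>y\<in>T. diff_count ?Q T (x \<otimes>\<^bsub>?Q\<^esub> inv\<^bsub>?Q\<^esub> y)) = (if x \<in> T then 10 else 6)"
    if x: "x \<in> carrier ?Q" for x
  proof -
    \<comment> \<open>Listing the eight elements leaves sixteen numerical cases, one for each
      element and each of the two sets.\<close>
    have "x \<in> {(0, 0), (0, 1), (0, 2), (0, 3), (1, 0), (1, 1), (1, 2), (1, 3)}"
      using x unfolding carrier_Z2_Z4 by blast
    then show ?thesis
      unfolding sum_diff_count_Z2_Z4[OF TQ x] using T by (elim insertE emptyE disjE) simp_all
  qed
  ultimately show ?thesis
    by (simp add: partial_geometric_difference_set_def comm_group_integer_mod_group_DirProd)
qed

text \<open>As d divides n, reduction modulo n preserves divisibility by d. The generator is reduced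
  modulo n so that it lies in the carrier even for d = n, which here is the case
  \<open>l = 1\<close>.\<close>

lemma generate_integer_mod_group_dvd:
  fixes d n :: nat
  assumes "n > 0" "d dvd n"
  shows "generate (integer_mod_group n) {int d mod int n}
       = {x \<in> carrier (integer_mod_group n). int d dvd x}"
proof -
  interpret group "integer_mod_group n"
    by simp
  let ?a = "int d mod int n"
  have a: "?a \<in> carrier (integer_mod_group n)"
    using assms by (simp add: carrier_integer_mod_group)
  have "generate (integer_mod_group n) {?a} = range (\<lambda>k::int. k * int d mod int n)"
    using a by (auto simp: generate_pow int_pow_integer_mod_group mod_simps full_SetCompr_eq)
  also have "\<dots> = {x \<in> carrier (integer_mod_group n). int d dvd x}"
  proof (intro equalityI subsetI)
    fix x assume "x \<in> range (\<lambda>k::int. k * int d mod int n)"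
    then show "x \<in> {x \<in> carrier (integer_mod_group n). int d dvd x}"
      using assms by (auto simp: carrier_integer_mod_group dvd_mod)
  next
    fix x assume "x \<in> {x \<in> carrier (integer_mod_group n). int d dvd x}"
    \<comment> \<open>The multiple is exact because d divides x, and the outer reduction changes
      nothing because x is already in the range from 0 to n - 1.\<close>
    then have "x = (x div int d) * int d mod int n"
      using assms by (auto simp: carrier_integer_mod_group)
    then show "x \<in> range (\<lambda>k::int. k * int d mod int n)"
      by blast
  qed
  finally show ?thesis .
qed

theorem theorem3p10:
  fixes l n :: nat and G :: "(int \<times> int) monoid"
    and H :: "int set" and Hplus :: "int \<Rightarrow> int set"
  assumes "l > 0"
    and "n = 4 * l"
    and "G = integer_mod_group 2 \<times>\<times> integer_mod_group n"
    and "H = generate (integer_mod_group n) {4 mod int n}"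
    and "\<And>i. i \<in> {0, 1, 2, 3} \<Longrightarrow>
           Hplus i = {x \<in> carrier (integer_mod_group n). [x = i] (mod 4)}"
  shows "partial_geometric_difference_set G (8 * l) (4 * l) (6 * l\<^sup>2) (10 * l\<^sup>2)
           (({0} \<times> (H \<union> Hplus 1)) \<union> ({1} \<times> (H \<union> Hplus 3)))
       \<and> partial_geometric_difference_set G (8 * l) (4 * l) (6 * l\<^sup>2) (10 * l\<^sup>2)
           (({1} \<times> (H \<union> Hplus 1)) \<union> ({0} \<times> (H \<union> Hplus 3)))"
proof -
  let ?Q = "integer_mod_group 2 \<times>\<times> integer_mod_group 4"
  let ?h = "\<lambda>(a::int, b::int). (a, b mod 4)"
  have carrier_G: "carrier G = {0, 1} \<times> {0..<4 * int l}"
    using assms(1-3) by (auto simp: carrier_integer_mod_group)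
  have comm: "comm_group G" and fin: "finite (carrier G)"
    unfolding carrier_G using assms(3) by (simp_all add: comm_group_integer_mod_group_DirProd)
  have hom: "?h \<in> hom G ?Q"
  proof (rule homI)
    fix x assume "x \<in> carrier G"
    then show "?h x \<in> carrier ?Q"
      by (auto simp: carrier_G carrier_integer_mod_group)
  next
    fix x y
    \<comment> \<open>Reducing modulo n before reducing modulo 4 is harmless because 4 divides
      n.\<close>
    show "?h (x \<otimes>\<^bsub>G\<^esub> y) = ?h x \<otimes>\<^bsub>?Q\<^esub> ?h y"
      using assms(2,3) by (cases x; cases y) (simp add: mod_mod_cancel mod_simps)
  qed
  interpret h: group_hom G ?Q ?h
    using hom comm comm_group_integer_mod_group_DirProd
    by (simp add: group_hom_def group_hom_axioms_def comm_group.axioms)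
  have surj: "?h ` carrier G = carrier ?Q"
  proof
    show "carrier ?Q \<subseteq> ?h ` carrier G"
    proof
      fix q assume "q \<in> carrier ?Q"
      \<comment> \<open>Each element of the quotient serves as its own preimage: its second
        coordinate is at most 3, which is below \<open>4 * l\<close> because \<open>l\<close> is
        positive.\<close>
      then have "q \<in> carrier G" "?h q = q"
        using assms(1) unfolding carrier_Z2_Z4 by (auto simp: carrier_G)
      then show "q \<in> ?h ` carrier G"
        by (metis imageI)
    qed
  qed (use h.hom_closed in blast)
  \<comment> \<open>The kernel consists of the pairs (0, b) with b a multiple of 4 below
    \<open>4 * l\<close>; division by 4 inverts the parametrisation.\<close>
  have "bij_betw (\<lambda>k. (0, 4 * int k)) {..<l} (kernel G ?Q ?h)"
    by (intro bij_betw_byWitness[where f' = "\<lambda>x. nat (snd x div 4)"])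
       (auto simp: kernel_def carrier_G)
  then have card_kernel: "l = card (kernel G ?Q ?h)"
    by (metis bij_betw_same_card card_lessThan)
  note preimage = h.partial_geometric_difference_set_preimage
    [OF comm surj fin partial_geometric_difference_set_Z2_Z4 card_kernel]
  have H: "H = {x \<in> {0..<4 * int l}. x mod 4 = 0}"
    using generate_integer_mod_group_dvd[of n 4] assms(1,2,4)
    by (simp add: carrier_integer_mod_group dvd_eq_mod_eq_0)
  have Hplus: "Hplus 1 = {x \<in> {0..<4 * int l}. x mod 4 = 1}"
      "Hplus 3 = {x \<in> {0..<4 * int l}. x mod 4 = 3}"
    using assms(1,2,5) by (auto simp: carrier_integer_mod_group cong_def)
  \<comment> \<open>\<open>H\<close> is now the residue class 0 modulo 4, so each union only
    prescribes the first coordinate together with the residue of the second.\<close>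
  have "{0} \<times> (H \<union> Hplus 1) \<union> {1} \<times> (H \<union> Hplus 3)
      = {x \<in> carrier G. ?h x \<in> {(0, 0), (0, 1), (1, 0), (1, 3)}}"
    and "{1} \<times> (H \<union> Hplus 1) \<union> {0} \<times> (H \<union> Hplus 3)
      = {x \<in> carrier G. ?h x \<in> {(1, 0), (1, 1), (0, 0), (0, 3)}}"
    unfolding H Hplus carrier_G by (simp_all add: set_eq_iff) blast+
  then show ?thesis
    using preimage[OF disjI1[OF refl]] preimage[OF disjI2[OF refl]] by (simp only: simp_thms)
qed

end
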